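(* Let $\mathcal{L}$ be a finite lattice with $n$ elements and let $x_1,\ldots,x_n$ be a reverse topological sort of $\mathcal{L}$. Starting with $B_1=\emptyset$, define inductively $B_{k+1}$ as the standard step for $B_k$ and $x_k$, that is, $B_{k+1}=(B_k\cup\{x_k\})\setminus\mathrm{uc}(x_k)$. Then, for each $k\in\{1,\ldots,n\}$, $B_k$ is a border for $x_k$.
   Context: $x\prec y$ means that $x$ is an immediate predecessor of $y$: $x<y$ and there is no $w$ with $x<w<y$. The upper cover of $x$ is $\mathrm{uc}(x)=\{y : x\prec y\}$. A reverse topological sort of $\mathcal{L}$ is an enumeration $x_1,\ldots,x_n$ of all its elements, each exactly once, such that $x_i\leq x_j$ always implies $j\leq i$. Given $x\in\mathcal{L}$ and $B\subseteq\mathcal{L}$, $B$ is a border for $x$ if: (i) for all $y\in B$, $y\not\leq x$; and (ii) for every $z\in\mathcal{L}$ with $x\prec z$ there is $y\in B$ with $y\leq z$. The standard step for $B$ and $x$ is the set $(B\cup\{x\})\setminus\mathrm{uc}(x)$ (a purely set-theoretic definition). *)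

theory Defs
  imports Main
begin

definition covered_by :: "'a::order \<Rightarrow> 'a \<Rightarrow> bool" (infix "\<prec>" 50)
  where "x \<prec> y \<longleftrightarrow> x < y \<and> \<not> (\<exists>w. x < w \<and> w < y)"

definition uc :: "'a::order \<Rightarrow> 'a set"
  where "uc x = {y. x \<prec> y}"

text \<open>An enumeration \<open>x 1, \<dots>, x n\<close> of the whole type; values of \<open>x\<close> outside \<open>{1..n}\<close>
  are irrelevant.\<close>
definition reverse_topological_sort :: "nat \<Rightarrow> (nat \<Rightarrow> 'a::order) \<Rightarrow> bool"
  where "reverse_topological_sort n x \<longleftrightarrow>
    bij_betw x {1..n} UNIV \<and> (\<forall>i\<in>{1..n}. \<forall>j\<in>{1..n}. x i \<le> x j \<longrightarrow> j \<le> i)"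

definition is_border :: "'a::order set \<Rightarrow> 'a \<Rightarrow> bool"
  where "is_border B x \<longleftrightarrow>
    (\<forall>y\<in>B. \<not> y \<le> x) \<and> (\<forall>z. x \<prec> z \<longrightarrow> (\<exists>y\<in>B. y \<le> z))"

definition standard_step :: "'a::order set \<Rightarrow> 'a \<Rightarrow> 'a set"
  where "standard_step B x = (B \<union> {x}) - uc x"

end

theory Submission
  imports Defs
begin

text \<open>Two invariants are maintained: \<open>B\<^sub>k\<close> consists of elements enumerated before \<open>x\<^sub>k\<close>, and every
  element enumerated before \<open>x\<^sub>k\<close> lies above an element of \<open>B\<^sub>k\<close>. The second one survives a standard
  step because an element is only discarded when the smaller element \<open>x\<^sub>k\<close> is put in. An upper cover
  of \<open>x\<^sub>k\<close> is enumerated before \<open>x\<^sub>k\<close>, whence the border property.\<close>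

lemma standard_step_subset: "standard_step B x \<subseteq> insert x B"
  by (auto simp: standard_step_def)

text \<open>Irreflexivity of \<open><\<close> keeps \<open>x\<close> out of
  \<open>uc x\<close>.\<close>

lemma standard_step_self: "x \<in> standard_step B x"
  by (simp add: standard_step_def uc_def covered_by_def)

text \<open>The witness is \<open>y\<close> itself unless it is removed; in that case
  \<open>x < y \<le> z\<close>, and \<open>x\<close> replaces it.\<close>

lemma standard_step_below:
  assumes "y \<in> B" "y \<le> z"
  shows "\<exists>w\<in>standard_step B x. w \<le> z"
proof (cases "y \<in> uc x")
  case True
  then have "x \<le> z"
    using assms(2) by (auto simp: uc_def covered_by_def)
  then show ?thesis
    using standard_step_self by blast
next
  case False
  then show ?thesis
    using assms by (auto simp: standard_step_def)
qed

lemma iterated_standard_step_invariant: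
  fixes x :: "nat \<Rightarrow> 'a::order"
  assumes init: "B 1 = {}"
    and step: "\<And>k. k \<in> {1..<n} \<Longrightarrow> B (k + 1) = standard_step (B k) (x k)"
    and "1 \<le> k" "k \<le> n"
  shows "B k \<subseteq> x ` {1..<k} \<and> (\<forall>j\<in>{1..<k}. \<exists>y\<in>B k. y \<le> x j)"
  using assms(3,4)
proof (induction k rule: dec_induct)
  case base
  then show ?case using init by simp
next
  case (step k)
  \<comment> \<open>The premise \<open>Suc k \<le> n\<close> puts \<open>k\<close> in
    \<open>{1..<n}\<close>, where the recursion is given.\<close>
  have B: "B (Suc k) = standard_step (B k) (x k)"
    using assms(2)[of k] step.hyps step.prems by simp
  have range: "{1..<Suc k} = insert k {1..<k}"
    using step.hyps by auto
  have IH: "B k \<subseteq> x ` {1..<k}" "\<forall>j\<in>{1..<k}. \<exists>y\<in>B k. y \<le> x j"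
    using step.IH step.prems by auto
  have "B (Suc k) \<subseteq> x ` {1..<Suc k}"
    unfolding B range using IH(1) standard_step_subset[of "B k" "x k"] by auto
  moreover have "\<exists>y\<in>B (Suc k). y \<le> x j" if j: "j \<in> {1..<Suc k}" for j
  \<comment> \<open>The new element \<open>x k\<close> is its own witness; older ones keep a witness
    through the step.\<close>
  proof (cases "j = k")
    case True
    then show ?thesis
      unfolding B using standard_step_self by blast
  next
    case False
    then have "j \<in> {1..<k}"
      using j by auto
    then obtain y where "y \<in> B k" "y \<le> x j"
      using IH(2) by blast
    then show ?thesis
      unfolding B by (rule standard_step_below)
  qed
  ultimately show ?case
    by blast
qed

theorem theorem2:
  fixes x :: "nat \<Rightarrow> 'a::{finite,lattice}"
    and B :: "nat \<Rightarrow> 'a set"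
    and n :: nat
  assumes "n = card (UNIV :: 'a set)"
    and "reverse_topological_sort n x"
    and "B 1 = {}"
    and "\<And>k. k \<in> {1..<n} \<Longrightarrow> B (k + 1) = standard_step (B k) (x k)"
  shows "\<forall>k\<in>{1..n}. is_border (B k) (x k)"
proof
  fix k assume k: "k \<in> {1..n}"
  have surj: "x ` {1..n} = UNIV"
    and mono: "\<And>i j. i \<in> {1..n} \<Longrightarrow> j \<in> {1..n} \<Longrightarrow> x i \<le> x j \<Longrightarrow> j \<le> i"
    using assms(2) unfolding reverse_topological_sort_def bij_betw_def by blast+
  have "1 \<le> k" "k \<le> n"
    using k by auto
  from iterated_standard_step_invariant[where n = n, OF assms(3,4) this]
  have sub: "B k \<subseteq> x ` {1..<k}" and below: "\<forall>j\<in>{1..<k}. \<exists>y\<in>B k. y \<le> x j"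
    by blast+
  show "is_border (B k) (x k)"
    unfolding is_border_def
  proof (intro conjI ballI allI impI)
    fix y assume "y \<in> B k"
    then obtain i where "i \<in> {1..<k}" "y = x i"
      using sub by blast
    \<comment> \<open>Otherwise the sort would give \<open>k \<le> i\<close>, against
      \<open>i < k\<close>.\<close>
    then show "\<not> y \<le> x k"
      using mono[of i k] k by auto
  next
    fix z assume "x k \<prec> z"
    then have "x k < z"
      by (simp add: covered_by_def)
    obtain j where j: "j \<in> {1..n}" "z = x j"
      using surj by (metis UNIV_I imageE)
    \<comment> \<open>The sort turns \<open>x k \<le> x j\<close> into \<open>j \<le> k\<close>;
      strictness of \<open>x k < z\<close> excludes equality.\<close>
    have "j \<le> k" "j \<noteq> k"
      using mono[of k j] k j \<open>x k < z\<close> by auto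
    then have "j \<in> {1..<k}"
      using j(1) by auto
    then show "\<exists>y\<in>B k. y \<le> z"
      using below j(2) by blast
  qed
qed

end
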